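(* Define polynomials $P_{1,m}(z)$ and $P_{2,m}(z)$, $m\ge 0$, by $P_{1,0}(z)=P_{2,0}(z)=\frac12$ and, for $m\geq 1$, by the recursions $$P_{1,m}(z) = z(1-z)\frac{d}{dz} P_{1,m-1}(z) + m z P_{1,m-1}(z) + \frac{1}{2} P_{2,m-1}(z),$$ $$P_{2,m}(z) = z(1-z)\frac{d}{dz} P_{2,m-1}(z) + (m+1)z P_{2,m-1}(z) - \frac{1}{2} P_{2,m-1}(z).$$ Then for each integer $m\geq 0$, $P_{1,m}(z)$ and $P_{2,m}(z)$ are polynomials in $z$ of degree $m$ with rational coefficients, and for all $|z|<1$ $$g_m(z) = \frac{P_{1,m}(z)}{(1-z)^{m+1}} + \frac{P_{2,m}(z)}{(1-z)^{m+2}}\, \frac{\arctan \Big (\sqrt{\frac{z}{1-z}}\Big )}{\sqrt{\frac{z}{1-z}}}.$$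
   Context: $C_n=\frac{1}{n+1}\binom{2n}{n}$ ($n\ge 0$) denotes the $n$-th Catalan number. For each integer $m\ge 0$ and $|z|<1$, $$g_m(z)=\sum_{n=0}^\infty \frac{2^{2n}n^m}{2n+1}\frac{z^n}{C_n},$$ with the convention $0^0=1$ (both for $n^m$ and for $z^n$). The quotient $\arctan(u)/u$ with $u=\sqrt{z/(1-z)}$ uses the principal branch of $\arctan$; it does not depend on the choice of the square root, and is interpreted as $1$ when $z=0$. *)

theory Defs
  imports "HOL-Analysis.Analysis" "HOL-Computational_Algebra.Polynomial"
begin

definition catalan :: "nat \<Rightarrow> real" where
  "catalan n = 1 / (real n + 1) * real ((2 * n) choose n)"

definition g_term :: "nat \<Rightarrow> complex \<Rightarrow> nat \<Rightarrow> complex" where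
  "g_term m z n =
     (2 ^ (2 * n) * of_nat n ^ m) / (2 * of_nat n + 1) * (z ^ n / of_real (catalan n))"

definition g :: "nat \<Rightarrow> complex \<Rightarrow> complex" where
  "g m z = (\<Sum>n. g_term m z n)"

text \<open>The step of each recursion is stated at index \<open>Suc m\<close>, so the coefficients
  \<open>m\<close> and \<open>m + 1\<close> of the usual form (for \<open>m \<ge> 1\<close>) appear as \<open>Suc m\<close> and \<open>Suc m + 1\<close>;
  \<open>[:0, 1:]\<close> is the indeterminate.\<close>

primrec P2 :: "nat \<Rightarrow> complex poly" where
  "P2 0 = [:1/2:]"
| "P2 (Suc m) =
     [:0, 1:] * (1 - [:0, 1:]) * pderiv (P2 m)
     + of_nat (Suc m + 1) * [:0, 1:] * P2 m - smult (1/2) (P2 m)"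

primrec P1 :: "nat \<Rightarrow> complex poly" where
  "P1 0 = [:1/2:]"
| "P1 (Suc m) =
     [:0, 1:] * (1 - [:0, 1:]) * pderiv (P1 m)
     + of_nat (Suc m) * [:0, 1:] * P1 m + smult (1/2) (P2 m)"

text \<open>\<open>Arctan\<close> is the principal branch of the complex arctangent. The quotient below is even
  in \<open>u\<close>, so choosing the principal root \<open>csqrt\<close> is immaterial.\<close>

definition arctan_quot :: "complex \<Rightarrow> complex" where
  "arctan_quot z =
     (if z = 0 then 1
      else Arctan (csqrt (z / (1 - z))) / csqrt (z / (1 - z)))"

end

theory Submission
  imports Defs
begin

text \<open>
  Both sides of the identity are carried from \<open>m\<close> to \<open>m + 1\<close> by the Euler operator
  \<open>z d/dz\<close>: on the series it multiplies the \<open>n\<close>-th term by \<open>n\<close>, and on the right-hand side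
  it acts as the two recursions, because \<open>A = arctan u / u\<close> with \<open>u\<^sup>2 = z / (1 - z)\<close>
  satisfies \<open>2 z (1 - z) A' = (1 - z) - A\<close>. The term \<open>1 - z\<close> of this equation feeds \<open>P2\<close> into
  the recursion for \<open>P1\<close>, and the term \<open>- A\<close> gives the summand \<open>- P2 / 2\<close> in the recursion
  for \<open>P2\<close> (\<open>g_euler_step\<close>, \<open>closed_form_euler_step\<close>). Hence only \<open>m = 0\<close> needs an argument
  of its own, apart from the point \<open>z = 0\<close>, where the operator gives no information and both
  sides vanish for \<open>m > 0\<close>.

  For \<open>m = 0\<close>, the ratio of successive Catalan numbers makes the coefficients
  \<open>a n = 4 ^ n / ((2 n + 1) C n)\<close> satisfy \<open>(2 n + 3) a (n + 1) = (2 n + 4) a n\<close>, which says that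
  the series solves \<open>2 z (1 - z) y' + (1 - 4 z) y = 1\<close>; so does the closed form
  (\<open>g_ode\<close>, \<open>closed_form_ode\<close>). The solutions of the homogeneous equation are the
  multiples of \<open>z\<close> to the power \<open>- 1 / 2\<close> times \<open>1 - z\<close> to the power \<open>- 3 / 2\<close>. The difference
  \<open>D\<close> of the two solutions is continuous at \<open>0\<close> and must therefore vanish. To avoid the
  branches of these powers, one shows that \<open>z (1 - z) ^ 3 D\<^sup>2\<close> is constant on the disc
  (\<open>g_0_eq_closed_form\<close>). All that this asks of the arctangent quotient is the differential
  equation off \<open>0\<close> and continuity at \<open>0\<close>.

  The degrees come from following the top coefficient through the recursions: it is
  unchanged at each step for \<open>P1\<close> and doubled for \<open>P2\<close>.
\<close>

section \<open>Degrees and coefficients\<close>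

lemma degree_eqI_coeff:
  fixes p :: "'a::zero poly"
  assumes "\<And>i. i > n \<Longrightarrow> coeff p i = 0" "coeff p n \<noteq> 0"
  shows "degree p = n"
  using assms by (metis degree_le le_antisym le_degree linorder_not_le)

text \<open>The part that the recursions for \<open>P1\<close> and \<open>P2\<close> have in common.\<close>

lemma coeff_euler_step:
  fixes p :: "complex poly"
  shows "coeff ([:0, 1:] * (1 - [:0, 1:]) * pderiv p + of_nat k * [:0, 1:] * p) i
       = of_nat i * coeff p i + (if i = 0 then 0 else (of_nat k - of_nat (i - 1)) * coeff p (i - 1))"
proof -
  have "[:0, 1:] * (1 - [:0, 1:]) * pderiv p + of_nat k * [:0, 1:] * p
      = [:0, 1:] * (pderiv p - [:0, 1:] * pderiv p + smult (of_nat k) p)"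
    by (simp add: algebra_simps of_nat_poly)
  then show ?thesis
    by (cases i; cases "i - 1") (simp_all add: coeff_pCons coeff_pderiv algebra_simps)
qed

lemma coeff_P2_Suc:
  "coeff (P2 (Suc m)) i = (of_nat i - 1/2) * coeff (P2 m) i
     + (if i = 0 then 0 else (of_nat (m + 2) - of_nat (i - 1)) * coeff (P2 m) (i - 1))"
  using coeff_euler_step[of "P2 m" "m + 2" i] by (simp add: algebra_simps)

lemma coeff_P1_Suc:
  "coeff (P1 (Suc m)) i = of_nat i * coeff (P1 m) i
     + (if i = 0 then 0 else (of_nat (m + 1) - of_nat (i - 1)) * coeff (P1 m) (i - 1))
     + coeff (P2 m) i / 2"
  using coeff_euler_step[of "P1 m" "m + 1" i] by (simp add: algebra_simps)

lemma coeff_P2_Rats: "coeff (P2 m) i \<in> \<rat>"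
  by (induction m arbitrary: i) (auto simp: coeff_P2_Suc coeff_pCons simp del: P2.simps(2) split: nat.split)

lemma coeff_P1_Rats: "coeff (P1 m) i \<in> \<rat>"
  by (induction m arbitrary: i) (auto simp: coeff_P1_Suc coeff_P2_Rats coeff_pCons simp del: P1.simps(2) split: nat.split)

text \<open>Passing from \<open>m\<close> to \<open>m + 1\<close>, the coefficient at \<open>m\<close> reappears at \<open>m + 1\<close> multiplied by
  \<open>(m + 2) - m = 2\<close> for \<open>P2\<close> and by \<open>(m + 1) - m = 1\<close> for \<open>P1\<close>; \<open>P2\<close>, being of degree \<open>m\<close>,
  adds nothing to the top coefficient of the next \<open>P1\<close>.\<close>

lemma P2_top: "(\<forall>i>m. coeff (P2 m) i = 0) \<and> 2 * coeff (P2 m) m = 2 ^ m"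
  by (induction m) (auto simp: coeff_P2_Suc coeff_pCons simp del: P2.simps(2) split: nat.split)

lemma P1_top: "(\<forall>i>m. coeff (P1 m) i = 0) \<and> coeff (P1 m) m = 1 / 2"
  by (induction m) (auto simp: coeff_P1_Suc P2_top coeff_pCons simp del: P1.simps(2) split: nat.split)

lemma degree_P2: "degree (P2 m) = m"
  by (rule degree_eqI_coeff) (use P2_top[of m] in auto)

lemma degree_P1: "degree (P1 m) = m"
  by (rule degree_eqI_coeff) (use P1_top[of m] in auto)

section \<open>The arctangent quotient\<close>

text \<open>The principal branch is cut along the imaginary axis outside \<open>(- \<i>, \<i>)\<close>, where \<open>s\<^sup>2\<close> is
  real and at most \<open>- 1\<close>. The condition \<open>Re (s\<^sup>2) > -1\<close> thus keeps \<open>s\<close> off the cut, and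
  it depends on the square only.\<close>

lemma Arctan_dom:
  assumes "Re (s\<^sup>2) > -1" "Re s = 0"
  shows "\<bar>Im s\<bar> < 1"
proof -
  have "(Im s)\<^sup>2 < 1"
    using assms by (simp add: power2_eq_square)
  then show ?thesis
    by (simp add: abs_square_less_1)
qed

text \<open>Both sides have tangent \<open>- s\<close> and real part strictly between \<open>- pi / 2\<close> and \<open>pi / 2\<close>,
  where the tangent is injective.\<close>

lemma Arctan_uminus:
  assumes "Re (s\<^sup>2) > -1"
  shows "Arctan (- s) = - Arctan s"
proof -
  have d: "Re s = 0 \<Longrightarrow> \<bar>Im s\<bar> < 1"
    using Arctan_dom assms by blast
  have ne: "s\<^sup>2 \<noteq> -1"
    using assms by auto
  have "tan (- Arctan s) = - s"
    using ne by simp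
  moreover have "Arctan (tan (- Arctan s)) = - Arctan s"
    by (rule Arctan_tan) (use Re_Arctan_bounds[OF d] in auto)
  ultimately show ?thesis by simp
qed

text \<open>The quotient is even, so any square root may replace the principal one. This matters
  because \<open>csqrt\<close> jumps across the negative reals, although the quotient does not.\<close>

lemma Arctan_csqrt_div_csqrt:
  assumes "Re (s\<^sup>2) > -1"
  shows "Arctan (csqrt (s\<^sup>2)) / csqrt (s\<^sup>2) = Arctan s / s"
proof -
  have "csqrt (s\<^sup>2) = s \<or> csqrt (s\<^sup>2) = - s"
    by (rule iffD1[OF power2_eq_iff power2_csqrt])
  then show ?thesis
  proof (elim disjE)
    assume "csqrt (s\<^sup>2) = s"
    then show ?thesis by (simp only:)
  next
    assume minus: "csqrt (s\<^sup>2) = - s"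
    show ?thesis
      unfolding minus Arctan_uminus[OF assms] by simp
  qed
qed

text \<open>With this, the quotient can be differentiated on the cut of \<open>csqrt\<close> as well: near a
  negative real number, \<open>\<i> * csqrt (- v)\<close> is a holomorphic square root of \<open>v\<close>.\<close>

lemma exists_sqrt_derivative:
  fixes w :: complex
  assumes "w \<noteq> 0"
  obtains s where "\<And>v. (s v)\<^sup>2 = v" "(s has_field_derivative 1 / (2 * s w)) (at w)"
proof (cases "w \<in> \<real>\<^sub>\<le>\<^sub>0")
  case False
  show ?thesis
    by (rule that[OF power2_csqrt has_field_derivative_csqrt[OF False, unfolded inverse_eq_divide]])
next
  case True
  then have w: "- w \<notin> \<real>\<^sub>\<le>\<^sub>0"
    using assms by (auto simp: complex_nonpos_Reals_iff complex_eq_iff)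
  have "((\<lambda>v. \<i> * csqrt (- v)) has_field_derivative \<i> * (-1 / (2 * csqrt (- w)))) (at w)"
    by (auto intro!: derivative_eq_intros w)
  also have "\<i> * (-1 / (2 * csqrt (- w))) = 1 / (2 * (\<i> * csqrt (- w)))"
    using assms by (simp add: field_simps)
  finally show ?thesis
    by (intro that[of "\<lambda>v. \<i> * csqrt (- v)"]) (auto simp: power_mult_distrib)
qed

lemma has_field_derivative_Arctan_csqrt_quot:
  assumes w: "w \<noteq> 0" "Re w > -1"
  shows "((\<lambda>v. Arctan (csqrt v) / csqrt v) has_field_derivative
           (1 / (1 + w) - Arctan (csqrt w) / csqrt w) / (2 * w)) (at w)"
proof -
  obtain s where s: "\<And>v. (s v)\<^sup>2 = v" "(s has_field_derivative 1 / (2 * s w)) (at w)"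
    using exists_sqrt_derivative[OF w(1)] by blast
  have sw: "s w \<noteq> 0" "s w * s w = w"
    using s(1)[of w] w(1) by (auto simp: power2_eq_square)
  have w1: "1 + w \<noteq> 0"
    using w(2) by (auto simp: complex_eq_iff)
  have quot: "Arctan (csqrt v) / csqrt v = Arctan (s v) / s v" if "Re v > -1" for v
    using Arctan_csqrt_div_csqrt[of "s v", unfolded s(1), OF that] .
  have A: "(Arctan has_field_derivative inverse (1 + (s w)\<^sup>2)) (at (s w))"
    by (rule has_field_derivative_Arctan) (rule Arctan_dom, use s(1)[of w] w(2) in auto)
  have dA: "((\<lambda>v. Arctan (s v)) has_field_derivative
            inverse (1 + (s w)\<^sup>2) * (1 / (2 * s w))) (at w)"
    by (rule DERIV_chain2[OF A s(2)])
  have "((\<lambda>v. Arctan (s v) / s v) has_field_derivative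
          (inverse (1 + (s w)\<^sup>2) * (1 / (2 * s w)) * s w - Arctan (s w) * (1 / (2 * s w)))
            / (s w * s w)) (at w)"
    by (rule DERIV_divide[OF dA s(2) sw(1)])
  also have "(inverse (1 + (s w)\<^sup>2) * (1 / (2 * s w)) * s w - Arctan (s w) * (1 / (2 * s w)))
            / (s w * s w) = (1 / (1 + w) - Arctan (s w) / s w) / (2 * w)"
  proof -
    have "inverse (1 + w) * (1 / (2 * s w)) * s w = 1 / (1 + w) / 2"
      using sw(1) by (simp add: inverse_eq_divide)
    moreover have "Arctan (s w) * (1 / (2 * s w)) = Arctan (s w) / s w / 2"
      by simp
    moreover have "(a / 2 - b / 2) / w = (a - b) / (2 * w)" for a b
      by (simp add: diff_divide_distrib)
    ultimately show ?thesis
      unfolding s(1) sw(2) by (simp only:)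
  qed
  also have "Arctan (s w) / s w = Arctan (csqrt w) / csqrt w"
    by (rule quot[OF w(2), symmetric])
  finally show ?thesis
  proof (rule has_field_derivative_transform_within_open)
    show "open {v. Re v > -1}"
      by (rule open_halfspace_Re_gt)
    show "w \<in> {v. Re v > -1}"
      using w(2) by simp
    show "Arctan (s v) / s v = Arctan (csqrt v) / csqrt v" if "v \<in> {v. Re v > -1}" for v
      by (rule quot[symmetric]) (use that in simp)
  qed
qed

text \<open>Since \<open>z / (1 - z) = 1 / (1 - z) - 1\<close>, this says that \<open>1 / (1 - z)\<close> lies in the right
  half-plane, as \<open>1 - z\<close> does.\<close>

lemma Re_div_one_minus:
  assumes "norm (z::complex) < 1"
  shows "Re (z / (1 - z)) > -1"
proof -
  have z1: "1 - z \<noteq> 0" using assms by auto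
  have "Re z < 1"
    using assms complex_Re_le_cmod[of z] by linarith
  then have "Re (1 / (1 - z)) > 0"
    using z1 by (simp add: Re_divide cmod_def divide_pos_pos complex_eq_iff sum_power2_gt_zero_iff)
  moreover have "z / (1 - z) = 1 / (1 - z) - 1"
    using z1 by (simp add: field_simps)
  ultimately show ?thesis by simp
qed

lemma arctan_quot_nonzero:
  "z \<noteq> 0 \<Longrightarrow> arctan_quot z = Arctan (csqrt (z / (1 - z))) / csqrt (z / (1 - z))"
  by (simp only: arctan_quot_def if_False)

text \<open>The differential equation \<open>2 z (1 - z) A' = (1 - z) - A\<close> on which the recursions rest.\<close>

lemma has_field_derivative_arctan_quot:
  assumes z: "norm z < 1" "z \<noteq> 0"
  shows "(arctan_quot has_field_derivative
           ((1 - z) - arctan_quot z) / (2 * z * (1 - z))) (at z)"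
proof -
  define w where "w = z / (1 - z)"
  have z1: "1 - z \<noteq> 0" using z by auto
  have w: "w \<noteq> 0" "Re w > -1"
    using z z1 Re_div_one_minus[OF z(1)] by (auto simp: w_def)
  have w1: "1 + w = 1 / (1 - z)"
    using z1 by (simp add: w_def field_simps)
  have dw: "((\<lambda>z. z / (1 - z)) has_field_derivative 1 / (1 - z)\<^sup>2) (at z)"
    using z1 by (auto intro!: derivative_eq_intros simp: power2_eq_square)
  have aq: "arctan_quot z = Arctan (csqrt w) / csqrt w"
    unfolding w_def by (rule arctan_quot_nonzero[OF z(2)])
  have "((\<lambda>z. Arctan (csqrt (z / (1 - z))) / csqrt (z / (1 - z))) has_field_derivative
          (1 / (1 + w) - Arctan (csqrt w) / csqrt w) / (2 * w) * (1 / (1 - z)\<^sup>2)) (at z)"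
    unfolding w_def
    by (rule DERIV_chain2[where f = "\<lambda>v. Arctan (csqrt v) / csqrt v", OF _ dw])
       (rule has_field_derivative_Arctan_csqrt_quot[OF w, unfolded w_def])
  also have "(1 / (1 + w) - Arctan (csqrt w) / csqrt w) / (2 * w) * (1 / (1 - z)\<^sup>2)
           = ((1 - z) - arctan_quot z) / (2 * z * (1 - z))"
  proof -
    have "(1 / (1 / (1 - z)) - a) / (2 * (z / (1 - z))) * (1 / (1 - z)\<^sup>2)
        = ((1 - z) - a) / (2 * z * (1 - z))" for a
      using z(2) z1 by (simp add: power2_eq_square)
    then show ?thesis
      unfolding w1 aq[symmetric] unfolding w_def .
  qed
  finally show ?thesis
  proof (rule has_field_derivative_transform_within_open)
    show "open (- {0::complex})" and "z \<in> - {0}"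
      using z(2) by auto
    show "Arctan (csqrt (v / (1 - v))) / csqrt (v / (1 - v)) = arctan_quot v" if "v \<in> - {0}" for v
      by (rule arctan_quot_nonzero[symmetric]) (use that in simp)
  qed
qed

text \<open>The limit of \<open>Arctan u / u\<close> at \<open>0\<close> is the derivative of \<open>Arctan\<close> there, which is \<open>1\<close>.\<close>

lemma isCont_arctan_quot_0: "isCont arctan_quot 0"
proof -
  have lim1: "((\<lambda>u. Arctan u / u) \<longlongrightarrow> 1) (at 0)"
    using has_field_derivative_Arctan[of 0] by (simp add: has_field_derivative_iff)
  have lim0: "((\<lambda>z. csqrt (z / (1 - z))) \<longlongrightarrow> 0) (at 0)"
  proof (rule tendsto_norm_zero_cancel)
    have "((\<lambda>z::complex. sqrt (norm (z / (1 - z)))) \<longlongrightarrow> sqrt (norm (0 / (1 - 0 :: complex)))) (at 0)"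
      by (intro tendsto_intros) auto
    then show "((\<lambda>z. norm (csqrt (z / (1 - z)))) \<longlongrightarrow> 0) (at 0)"
      by (simp add: norm_csqrt)
  qed
  have near: "\<forall>\<^sub>F z::complex in at 0. z \<noteq> 0 \<and> z \<noteq> 1"
    unfolding eventually_at_topological by (intro exI[of _ "- {1}"]) auto
  have nz: "\<forall>\<^sub>F z in at 0. csqrt (z / (1 - z)) \<noteq> 0"
    using near by eventually_elim simp
  have "((\<lambda>z. Arctan (csqrt (z / (1 - z))) / csqrt (z / (1 - z))) \<longlongrightarrow> 1) (at 0)"
    by (rule filterlim_compose[OF lim1 filterlim_atI[OF lim0 nz]])
  then have "(arctan_quot \<longlongrightarrow> 1) (at 0)"
    by (rule Lim_transform_eventually)
       (rule eventually_mono[OF near], rule arctan_quot_nonzero[symmetric], rule conjunct1)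
  then show ?thesis
    by (simp add: isCont_def arctan_quot_def)
qed

section \<open>The closed forms\<close>

definition closed_form :: "nat \<Rightarrow> complex \<Rightarrow> complex" where
  "closed_form m z = poly (P1 m) z / (1 - z) ^ (m + 1)
                   + poly (P2 m) z / (1 - z) ^ (m + 2) * arctan_quot z"

lemma has_field_derivative_poly_div_power:
  fixes p :: "complex poly"
  assumes z1: "1 - z \<noteq> 0"
  shows "((\<lambda>z. poly p z / (1 - z) ^ Suc k) has_field_derivative
      ((1 - z) * poly (pderiv p) z + of_nat (Suc k) * poly p z) / ((1 - z) ^ Suc k * (1 - z))) (at z)"
proof -
  have "((\<lambda>z. (1 - z) ^ Suc k) has_field_derivative - (of_nat (Suc k) * (1 - z) ^ k)) (at z)"
    by (rule derivative_eq_intros refl | simp)+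
  from DERIV_divide[OF poly_DERIV[of p] this] z1
  have quotient_rule: "((\<lambda>z. poly p z / (1 - z) ^ Suc k) has_field_derivative
      (poly (pderiv p) z * (1 - z) ^ Suc k - poly p z * - (of_nat (Suc k) * (1 - z) ^ k))
        / ((1 - z) ^ Suc k * (1 - z) ^ Suc k)) (at z)"
    by simp
  have "(x' * (t * q) - x * - (n * q)) / (t * q * (t * q)) = (t * x' + n * x) / (t * q * t)"
    if "t \<noteq> 0" "q \<noteq> 0" for t q x x' n :: complex
    using that by (simp add: divide_simps) (simp add: algebra_simps)
  from DERIV_cong[OF quotient_rule, OF this[of "1 - z" "(1 - z) ^ k", folded power_Suc]] z1
  show ?thesis by simp
qed

text \<open>The recursions were made for this: the quotient rule gives the terms with \<open>pderiv\<close> and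
  with \<open>m + 1\<close> and \<open>m + 2\<close>, and the derivative of the arctangent quotient gives the two terms
  with the factor \<open>1 / 2\<close>.\<close>

lemma closed_form_euler_step:
  assumes z: "norm z < 1" "z \<noteq> 0"
  shows "(closed_form m has_field_derivative closed_form (Suc m) z / z) (at z)"
proof -
  have z1: "1 - z \<noteq> 0" using z by auto
  have deriv: "(closed_form m has_field_derivative
      ((1 - z) * poly (pderiv (P1 m)) z + of_nat (Suc m) * poly (P1 m) z) / ((1 - z) ^ Suc m * (1 - z))
      + (((1 - z) * poly (pderiv (P2 m)) z + of_nat (Suc (Suc m)) * poly (P2 m) z)
            / ((1 - z) ^ Suc (Suc m) * (1 - z)) * arctan_quot z
         + ((1 - z) - arctan_quot z) / (2 * z * (1 - z)) * (poly (P2 m) z / (1 - z) ^ Suc (Suc m)))) (at z)"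
    unfolding closed_form_def [abs_def] Suc_eq_plus1 [symmetric] add_2_eq_Suc'
    by (intro DERIV_add DERIV_mult has_field_derivative_poly_div_power
          has_field_derivative_arctan_quot z z1)
  \<comment> \<open>The identity between the derivative and the recursions, with \<open>t\<close> for \<open>1 - z\<close>, \<open>q\<close> for
    \<open>(1 - z) ^ Suc m\<close>, \<open>A\<close> for the arctangent quotient, and \<open>p, p', r, r'\<close> for the values of
    \<open>P1 m\<close>, \<open>P2 m\<close> and their derivatives.\<close>
  have algebra: "(t * p' + a * p) / (q * t) + ((t * r' + b * r) / (q * t * t) * A
              + (t - A) / (2 * z * t) * (r / (q * t)))
           = ((z * t * p' + a * z * p + r / 2) / (q * t)
              + (z * t * r' + b * z * r - r / 2) / (q * t * t) * A) / z"
    if "t \<noteq> 0" "q \<noteq> 0" for t q p p' r r' a b A :: complex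
    using that z(2) by (simp add: field_simps)
  have P1_step: "poly (P1 (Suc m)) z = z * (1 - z) * poly (pderiv (P1 m)) z
      + of_nat (Suc m) * z * poly (P1 m) z + poly (P2 m) z / 2"
    and P2_step: "poly (P2 (Suc m)) z = z * (1 - z) * poly (pderiv (P2 m)) z
      + of_nat (Suc (Suc m)) * z * poly (P2 m) z - poly (P2 m) z / 2"
    by (simp_all add: of_nat_poly algebra_simps)
  have powers: "(1 - z) ^ Suc (Suc m) = (1 - z) ^ Suc m * (1 - z)"
      "(1 - z) ^ Suc (Suc (Suc m)) = (1 - z) ^ Suc m * (1 - z) * (1 - z)"
    by simp_all
  show ?thesis
  proof (rule DERIV_cong[OF deriv])
    show "((1 - z) * poly (pderiv (P1 m)) z + of_nat (Suc m) * poly (P1 m) z) / ((1 - z) ^ Suc m * (1 - z))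
      + (((1 - z) * poly (pderiv (P2 m)) z + of_nat (Suc (Suc m)) * poly (P2 m) z)
            / ((1 - z) ^ Suc (Suc m) * (1 - z)) * arctan_quot z
         + ((1 - z) - arctan_quot z) / (2 * z * (1 - z)) * (poly (P2 m) z / (1 - z) ^ Suc (Suc m)))
      = closed_form (Suc m) z / z"
      unfolding closed_form_def Suc_eq_plus1 [symmetric] add_2_eq_Suc' powers P1_step P2_step
      by (rule algebra) (use z1 in simp_all)
  qed
qed

text \<open>With \<open>closed_form 1\<close> in the place of \<open>z y'\<close>, this is the equation
  \<open>2 z (1 - z) y' + (1 - 4 z) y = 1\<close> for \<open>y = closed_form 0\<close>.\<close>

lemma closed_form_ode:
  assumes "norm z < 1"
  shows "2 * (1 - z) * closed_form 1 z + (1 - 4 * z) * closed_form 0 z = 1"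
proof -
  have z1: "1 - z \<noteq> 0" using assms by auto
  show ?thesis using z1
    by (simp add: closed_form_def pderiv_pCons divide_simps power2_eq_square power3_eq_cube)
       (simp add: algebra_simps)
qed

lemma closed_form_at_0: "closed_form (Suc m) 0 = 0"
  by (simp add: closed_form_def arctan_quot_def)

section \<open>The power series\<close>

lemma power_series_euler_step:
  fixes c :: "nat \<Rightarrow> complex"
  assumes sm: "\<And>z. norm z < 1 \<Longrightarrow> summable (\<lambda>n. c n * z ^ n)" and z: "norm z < 1"
  shows "summable (\<lambda>n. (of_nat n * c n) * z ^ n)"
    and "z \<noteq> 0 \<Longrightarrow> ((\<lambda>z. \<Sum>n. c n * z ^ n) has_field_derivative
           (\<Sum>n. (of_nat n * c n) * z ^ n) / z) (at z)"
proof -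
  have "summable (\<lambda>n. diffs c n * z ^ n)"
    by (rule termdiff_converges[OF z sm])
  from sums_mult[OF diffs_equiv[OF this], of z]
  have "(\<lambda>n. z * (of_nat n * c n * z ^ (n - Suc 0))) sums (z * (\<Sum>n. diffs c n * z ^ n))" .
  also have "(\<lambda>n. z * (of_nat n * c n * z ^ (n - Suc 0))) = (\<lambda>n. (of_nat n * c n) * z ^ n)"
  proof
    show "z * (of_nat n * c n * z ^ (n - Suc 0)) = (of_nat n * c n) * z ^ n" for n
      by (cases n) auto
  qed
  finally have S: "(\<lambda>n. (of_nat n * c n) * z ^ n) sums (z * (\<Sum>n. diffs c n * z ^ n))" .
  then show "summable (\<lambda>n. (of_nat n * c n) * z ^ n)"
    by (simp add: sums_iff)
  show "((\<lambda>z. \<Sum>n. c n * z ^ n) has_field_derivative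
           (\<Sum>n. (of_nat n * c n) * z ^ n) / z) (at z)" if "z \<noteq> 0"
    using termdiffs_strong'[OF sm z] sums_unique[OF S, symmetric] that by simp
qed

definition g_coeff :: "nat \<Rightarrow> real" where
  "g_coeff n = 4 ^ n / ((2 * real n + 1) * catalan n)"

lemma g_term_eq: "g_term m z n = (of_nat n ^ m * of_real (g_coeff n)) * z ^ n"
  by (simp add: g_term_def g_coeff_def power_mult)

lemma catalan_pos: "catalan n > 0"
  by (simp add: catalan_def)

lemma catalan_Suc: "(real n + 2) * catalan (Suc n) = 2 * (2 * real n + 1) * catalan n"
proof -
  have c: "catalan k = fact (2 * k) / (fact k * fact k * (real k + 1))" for k
    by (simp add: catalan_def binomial_fact)
  have "fact (2 * Suc n) = (2 * real n + 2) * (2 * real n + 1) * (fact (2 * n) :: real)"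
    by (simp add: algebra_simps)
  moreover have "fact (Suc n) = (real n + 1) * (fact n :: real)"
    by simp
  ultimately have "catalan (Suc n) = (2 * real n + 2) * (2 * real n + 1) * fact (2 * n)
      / ((real n + 1) * fact n * ((real n + 1) * fact n) * (real n + 2))"
    unfolding c by (simp only: ) simp
  also have "\<dots> = 2 * (2 * real n + 1) / (real n + 2) * catalan n"
    unfolding c by (simp add: divide_simps) (simp add: algebra_simps)
  finally show ?thesis by (simp add: field_simps)
qed

text \<open>This ratio is the source of the differential equation.\<close>

lemma g_coeff_Suc: "(2 * real n + 3) * g_coeff (Suc n) = (2 * real n + 4) * g_coeff n"
proof -
  have "g_coeff (Suc n) = 4 * 4 ^ n / ((2 * real n + 3) * catalan (Suc n))"
    by (simp add: g_coeff_def algebra_simps)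
  moreover have "catalan (Suc n) = 2 * (2 * real n + 1) * catalan n / (real n + 2)"
    using catalan_Suc[of n] by (simp add: field_simps)
  ultimately have "(2 * real n + 3) * g_coeff (Suc n)
      = (2 * real n + 3) * (4 * 4 ^ n / ((2 * real n + 3) * (2 * (2 * real n + 1) * catalan n / (real n + 2))))"
    by (simp only:)
  also have "\<dots> = 2 * (real n + 2) * (4 ^ n / ((2 * real n + 1) * catalan n))"
  proof -
    have cancel: "a * (4 * q / (a * (2 * b * c / y))) = 2 * y * (q / (b * c))"
      if "a \<noteq> 0" "b \<noteq> 0" "c \<noteq> 0" "y \<noteq> 0" for a q b c y :: real
      using that by (simp add: field_simps)
    show ?thesis
      by (rule cancel) (use catalan_pos[of n] in auto)
  qed
  also have "\<dots> = (2 * real n + 4) * g_coeff n"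
    by (simp add: g_coeff_def)
  finally show ?thesis .
qed

lemma g_coeff_pos: "g_coeff n > 0"
  using catalan_pos[of n] by (simp add: g_coeff_def)

text \<open>A crude bound, enough for convergence in the unit disc: the ratio \<open>(2 n + 4) / (2 n + 3)\<close>
  does not exceed \<open>(n + 2) / (n + 1)\<close>.\<close>

lemma g_coeff_le: "g_coeff n \<le> real (Suc n)"
proof (induction n)
  case 0
  show ?case by (simp add: g_coeff_def catalan_def)
next
  case (Suc n)
  have "(2 * real n + 3) * g_coeff (Suc n) \<le> (2 * real n + 4) * real (Suc n)"
    unfolding g_coeff_Suc using Suc by (intro mult_left_mono) auto
  also have "\<dots> \<le> (2 * real n + 3) * real (Suc (Suc n))"
    by (simp add: algebra_simps)
  finally show ?case
    by (subst (asm) mult_le_cancel_left_pos) auto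
qed

lemma summable_g_coeff:
  assumes "norm (z::complex) < 1"
  shows "summable (\<lambda>n. of_real (g_coeff n) * z ^ n)"
proof (rule summable_comparison_test)
  have "summable (\<lambda>n. diffs (\<lambda>_. 1) n * norm z ^ n)"
    by (rule termdiff_converges[where K = 1]) (use assms in \<open>auto simp: summable_geometric\<close>)
  then show "summable (\<lambda>n. real (Suc n) * norm z ^ n)"
    by (simp add: diffs_def)
  show "\<exists>N. \<forall>n\<ge>N. norm (of_real (g_coeff n) * z ^ n) \<le> real (Suc n) * norm z ^ n"
    using g_coeff_le g_coeff_pos
    by (auto simp: norm_mult norm_power abs_of_pos intro!: mult_right_mono simp del: of_nat_Suc)
qed

lemma summable_g_term: "norm z < 1 \<Longrightarrow> summable (g_term m z)"
proof (induction m arbitrary: z)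
  case 0
  then show ?case
    using summable_g_coeff by (simp add: g_term_eq [abs_def])
next
  case (Suc m)
  show ?case
    using power_series_euler_step(1)[of "\<lambda>n. of_nat n ^ m * of_real (g_coeff n)" z] Suc
    by (simp add: g_term_eq [abs_def] mult.assoc)
qed

lemma g_euler_step:
  assumes "norm z < 1" "z \<noteq> 0"
  shows "(g m has_field_derivative g (Suc m) z / z) (at z)"
  using power_series_euler_step(2)[of "\<lambda>n. of_nat n ^ m * of_real (g_coeff n)" z] assms
    summable_g_term[of _ m]
  by (simp add: g_def [abs_def] g_term_eq [abs_def] mult.assoc)

lemma g_at_0: "g 0 0 = 1" "g (Suc m) 0 = 0"
proof -
  show "g 0 0 = 1"
    using powser_zero[of "\<lambda>n. complex_of_real (g_coeff n)"]
    by (simp add: g_def g_term_eq [abs_def] g_coeff_def catalan_def)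
  show "g (Suc m) 0 = 0"
    using powser_zero[of "\<lambda>n. of_nat n ^ Suc m * complex_of_real (g_coeff n)"]
    by (simp add: g_def g_term_eq [abs_def])
qed

text \<open>Multiplying \<open>g_coeff_Suc\<close> by \<open>z ^ (n + 1)\<close> and summing over \<open>n\<close> gives
  \<open>2 g 1 + g 0 - 1 = z (2 g 1 + 4 g 0)\<close>; the \<open>1\<close> is the term of index \<open>0\<close>, which the shift omits.\<close>

lemma g_ode:
  assumes z: "norm z < 1"
  shows "2 * (1 - z) * g 1 z + (1 - 4 * z) * g 0 z = 1"
proof -
  let ?a = "\<lambda>n. complex_of_real (g_coeff n)"
  have s: "g_term m z sums g m z" for m
    using summable_g_term[OF z] by (simp add: g_def summable_sums)
  have L: "(\<lambda>n. 2 * g_term 1 z n + g_term 0 z n) sums (2 * g 1 z + g 0 z)"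
    by (intro sums_add sums_mult s)
  have R: "(\<lambda>n. z * (2 * g_term 1 z n + 4 * g_term 0 z n)) sums (z * (2 * g 1 z + 4 * g 0 z))"
    by (intro sums_add sums_mult s)
  have "2 * g_term 1 z (Suc n) + g_term 0 z (Suc n) = z * (2 * g_term 1 z n + 4 * g_term 0 z n)"
    for n
  proof -
    have "(2 * of_nat n + 3) * ?a (Suc n) = (2 * of_nat n + 4) * ?a n"
      using arg_cong[OF g_coeff_Suc[of n], of complex_of_real] by simp
    then have "(2 * of_nat n + 3) * ?a (Suc n) * z ^ Suc n = (2 * of_nat n + 4) * ?a n * z ^ Suc n"
      by (rule arg_cong)
    then show ?thesis
      by (simp add: g_term_eq algebra_simps)
  qed
  then have "(\<lambda>n. 2 * g_term 1 z (Suc n) + g_term 0 z (Suc n)) sums (z * (2 * g 1 z + 4 * g 0 z))"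
    using R by presburger
  from sums_Suc[OF this]
  have "(\<lambda>n. 2 * g_term 1 z n + g_term 0 z n) sums (z * (2 * g 1 z + 4 * g 0 z) + 1)"
    by (simp add: g_term_eq g_coeff_def catalan_def)
  from sums_unique2[OF L this] show ?thesis
    by (simp add: algebra_simps)
qed

lemma isCont_g_0_at_0: "isCont (g 0) 0"
  using termdiffs_strong'[of 1 "\<lambda>n. complex_of_real (g_coeff n)" 0] summable_g_coeff
  by (auto simp: g_def [abs_def] g_term_eq [abs_def] intro: DERIV_isCont)

section \<open>Equality of the series and the closed form\<close>

lemma isCont_closed_form_0_at_0: "isCont (closed_form 0) 0"
  unfolding closed_form_def [abs_def]
  by (intro continuous_intros isCont_arctan_quot_0) auto

text \<open>The difference \<open>D\<close> of the two sides solves \<open>2 z (1 - z) D' + (1 - 4 z) D = 0\<close> off \<open>0\<close>.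
  Hence \<open>z (1 - z) ^ 3 D\<^sup>2\<close> has derivative \<open>0\<close> there. It is continuous on the disc and vanishes
  at \<open>0\<close>, so it vanishes everywhere.\<close>

lemma g_0_eq_closed_form:
  assumes "norm z < 1"
  shows "g 0 z = closed_form 0 z"
proof (cases "z = 0")
  case True
  then show ?thesis
    by (simp add: g_at_0 closed_form_def arctan_quot_def)
next
  case False
  define D where "D = (\<lambda>z. g 0 z - closed_form 0 z)"
  define E where "E = (\<lambda>z. z * (1 - z) ^ 3 * (D z)\<^sup>2)"
  have dD: "(D has_field_derivative (g 1 x - closed_form 1 x) / x) (at x)"
    if "norm x < 1" "x \<noteq> 0" for x
    unfolding D_def
    using DERIV_diff[OF g_euler_step[OF that, of 0] closed_form_euler_step[OF that, of 0]]
    by (simp add: diff_divide_distrib)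
  have dE: "(E has_field_derivative 0) (at x)" if x: "norm x < 1" "x \<noteq> 0" for x
  proof -
    have homogeneous: "2 * (1 - x) * (g 1 x - closed_form 1 x) = - ((1 - 4 * x) * D x)"
      using g_ode[OF x(1)] closed_form_ode[OF x(1)] unfolding D_def by algebra
    have "((\<lambda>z. z * (1 - z) ^ 3) has_field_derivative (1 - x)\<^sup>2 * (1 - 4 * x)) (at x)"
      by (auto intro!: derivative_eq_intros simp: power2_eq_square power3_eq_cube algebra_simps)
    from DERIV_mult[OF this DERIV_power[OF dD[OF x], of 2]]
    have "(E has_field_derivative
        (1 - x)\<^sup>2 * (1 - 4 * x) * (D x)\<^sup>2
        + 2 * ((g 1 x - closed_form 1 x) / x * D x) * (x * (1 - x) ^ 3)) (at x)"
      by (simp add: E_def)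
    also have "(1 - x)\<^sup>2 * (1 - 4 * x) * (D x)\<^sup>2
        + 2 * ((g 1 x - closed_form 1 x) / x * D x) * (x * (1 - x) ^ 3)
        = (1 - x)\<^sup>2 * D x * ((1 - 4 * x) * D x + 2 * (1 - x) * (g 1 x - closed_form 1 x))"
    proof -
      have "2 * (d / x * D x) * (x * y) = 2 * d * D x * y" for d y
        using x(2) by simp
      then show ?thesis
        by (simp only:) (simp add: power2_eq_square power3_eq_cube algebra_simps)
    qed
    also have "\<dots> = 0"
      unfolding homogeneous by simp
    finally show ?thesis .
  qed
  have "isCont D x" if "norm x < 1" for x
    using that dD[of x] isCont_g_0_at_0 isCont_closed_form_0_at_0
    by (cases "x = 0") (auto simp: D_def intro: DERIV_isCont)
  then have "continuous_on (ball 0 1) E"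
    unfolding E_def by (intro continuous_intros continuous_at_imp_continuous_on) auto
  then obtain c where c: "\<And>x. x \<in> ball 0 1 \<Longrightarrow> E x = c"
    using DERIV_zero_connected_constant[of "ball 0 1" "{0}" E] dE by auto
  have "E z = E 0"
    using c[of 0] c[of z] assms by simp
  then have "D z = 0"
    using False assms by (auto simp: E_def)
  then show ?thesis by (simp add: D_def)
qed

lemma g_eq_closed_form:
  assumes "norm z < 1"
  shows "g m z = closed_form m z"
  using assms
proof (induction m arbitrary: z)
  case 0
  then show ?case by (rule g_0_eq_closed_form)
next
  case (Suc m)
  show ?case
  proof (cases "z = 0")
    case True
    then show ?thesis
      by (simp add: g_at_0 closed_form_at_0)
  next
    case False
    have "(closed_form m has_field_derivative g (Suc m) z / z) (at z)"
      by (rule has_field_derivative_transform_within_open[OF g_euler_step[OF Suc.prems False],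
            where S = "ball 0 1"])
         (use Suc in auto)
    from DERIV_unique[OF this closed_form_euler_step[OF Suc.prems False]] False
    show ?thesis by simp
  qed
qed

theorem theorem5:
  fixes m :: nat
  shows "degree (P1 m) = m \<and> (\<forall>i. coeff (P1 m) i \<in> \<rat>) \<and>
    degree (P2 m) = m \<and> (\<forall>i. coeff (P2 m) i \<in> \<rat>) \<and>
    (\<forall>z::complex. norm z < 1 \<longrightarrow>
       summable (g_term m z) \<and>
       g m z = poly (P1 m) z / (1 - z) ^ (m + 1)
             + poly (P2 m) z / (1 - z) ^ (m + 2) * arctan_quot z)"
  by (intro conjI allI impI degree_P1 coeff_P1_Rats degree_P2 coeff_P2_Rats summable_g_term
        g_eq_closed_form[unfolded closed_form_def])

end
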